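(* Let $d\geqslant 1$ be an integer and let $A\subseteq\mathbb{R}^d$ be a bounded infinite set. Suppose that there exists a sequence $\{A_n\}_{n=1}^\infty$ of finite subsets of $A$ such that \[ \lim_{n\to\infty}\#A_n=+\infty\quad\text{and}\quad\lim_{n\to\infty}\frac{-\log\delta(A_n)}{\#A_n}=0. \] Then there exists a closed set $E\subseteq[0,1]^d$ with $\mu(E)>0$ such that $E$ contains no affine copies of $A$.
   Context: $\|\cdot\|$ is the Euclidean norm on $\mathbb{R}^d$, $\mu$ is $d$-dimensional Lebesgue measure, and $\#$ denotes cardinality. For a finite set $F\subseteq\mathbb{R}^d$ with $\#F\geqslant 2$, \[ \delta(F):=\frac{\min\{\|\boldsymbol{x}-\boldsymbol{y}\|:\boldsymbol{x}\neq\boldsymbol{y}\in F\}}{\max\{\|\boldsymbol{z}\|:\boldsymbol{z}\in F\}}. \] (Since $\#A_n\to+\infty$, $\delta(A_n)$ is defined for all large $n$, which is all the limit needs.) $\mathrm{GL}_d(\mathbb{R})$ is the set of invertible $d\times d$ real matrices. An affine copy of $A$ is a set $TA+\boldsymbol{x}=\{T\boldsymbol{a}+\boldsymbol{x}:\boldsymbol{a}\in A\}$ with $T\in\mathrm{GL}_d(\mathbb{R})$, $\boldsymbol{x}\in\mathbb{R}^d$. "$E$ contains no affine copies of $A$" means $TA+\boldsymbol{x}\not\subseteq E$ for all such $T$ and $\boldsymbol{x}$. *)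

theory Defs
  imports "HOL-Analysis.Analysis"
begin

(* Meaningful only for finite F with at least two points; otherwise Min and Max may be
   applied to empty or infinite sets and the value is unspecified. *)
definition sep_ratio :: "(real^'n) set \<Rightarrow> real" where
  "sep_ratio F =
     Min {norm (x - y) | x y. x \<in> F \<and> y \<in> F \<and> x \<noteq> y} / Max {norm z | z. z \<in> F}"

definition affine_copies :: "(real^'n) set \<Rightarrow> (real^'n) set set" where
  "affine_copies A =
     {(\<lambda>a. T *v a + x) ` A | (T :: real^'n^'n) (x :: real^'n). invertible T}"

definition contains_no_affine_copies :: "(real^'n) set \<Rightarrow> (real^'n) set \<Rightarrow> bool" where
  "contains_no_affine_copies E A \<longleftrightarrow> (\<forall>B \<in> affine_copies A. \<not> B \<subseteq> E)"

end

theory Submission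
  imports Defs
begin

text \<open>
  Fix M and consider only those T whose entries are at most M in absolute value and which satisfy
  norm v \<le> M norm (T v). Rescale \<open>S n\<close> to maximal norm 1. On a grid of mesh comparable to
  its separation, every affine copy of \<open>S n\<close> occupies \<open>card (S n)\<close> distinct cells, and
  up to an error of one mesh size the number of copies is polynomial in \<open>1 / sep_ratio (S n)\<close>.
  A random selection of a proportion p of the cells misses a given copy with probability about
  \<open>exp (- p * card (S n))\<close>, so for large n some selection meets all copies. The chosen cells,
  slightly enlarged, are tiled over space at the original scale of \<open>S n\<close>, which may be
  arbitrarily small; the result is an open set of small measure meeting every copy of A. Removing such
  sets for all M from the unit cube leaves E.
\<close>

section \<open>Small hitting sets by a counting argument\<close>

text \<open>A union bound over \<open>m\<close>-tuples of points of \<open>X\<close>: exactly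
  \<open>(card X - N) ^ m\<close> of them avoid a given \<open>B i\<close>, so by
  \<open>less\<close> some tuple avoids none of the \<open>B i\<close>, and its range serves as
  \<open>H\<close>. Tuples may repeat entries, so the size is only bounded by
  \<open>m\<close>.\<close>

lemma hitting_set_count:
  assumes X: "finite X" and I: "finite I"
    and B: "\<And>i. i \<in> I \<Longrightarrow> B i \<subseteq> X \<and> card (B i) = N"
    and less: "card I * (card X - N) ^ m < card X ^ m"
  shows "\<exists>H. H \<subseteq> X \<and> card H \<le> m \<and> (\<forall>i\<in>I. B i \<inter> H \<noteq> {})"
proof -
  let ?P = "\<lambda>Y. PiE {..<m} (\<lambda>_. Y)"
  have "card (\<Union>i\<in>I. ?P (X - B i)) \<le> (\<Sum>i\<in>I. card (?P (X - B i)))"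
    by (rule card_UN_le[OF I])
  also have "\<dots> = (\<Sum>i\<in>I. (card X - N) ^ m)"
  proof -
    have "card (X - B i) = card X - N" if "i \<in> I" for i
      using B[OF that] X by (simp add: card_Diff_subset finite_subset[OF _ X])
    then show ?thesis by (simp add: card_PiE)
  qed
  also have "\<dots> < card (?P X)"
    using less by (simp add: card_PiE)
  finally have less_card: "card (\<Union>i\<in>I. ?P (X - B i)) < card (?P X)" .
  have "finite (\<Union>i\<in>I. ?P (X - B i))"
    using I X by (intro finite_UN_I finite_PiE) auto
  then have "\<not> ?P X \<subseteq> (\<Union>i\<in>I. ?P (X - B i))"
    using less_card card_mono leD by blast
  then obtain f where f: "f \<in> ?P X" "\<And>i. i \<in> I \<Longrightarrow> f \<notin> ?P (X - B i)"
    by blast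
  have "B i \<inter> f ` {..<m} \<noteq> {}" if "i \<in> I" for i
  proof
    assume "B i \<inter> f ` {..<m} = {}"
    then have "f \<in> ?P (X - B i)"
      using f(1) by (auto simp: PiE_iff)
    with f(2) that show False by blast
  qed
  moreover have "f ` {..<m} \<subseteq> X" using f(1) by auto
  moreover have "card (f ` {..<m}) \<le> m"
    using card_image_le[of "{..<m}" f] by simp
  ultimately show ?thesis by blast
qed

text \<open>Exponential form of the previous count, with \<open>p * card X\<close> draws rounded
  down: each draw misses a given \<open>B i\<close> with probability \<open>1 - N / K\<close>, which
  is at most \<open>exp (- (N / K))\<close>.\<close>

lemma hitting_set:
  fixes p :: real
  assumes X: "finite X" and I: "finite I" and p: "p \<ge> 0"
    and B: "\<And>i. i \<in> I \<Longrightarrow> B i \<subseteq> X \<and> card (B i) = N"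
    and less: "real (card I) * exp (1 - p * N) < 1"
  shows "\<exists>H. H \<subseteq> X \<and> real (card H) \<le> p * card X \<and> (\<forall>i\<in>I. B i \<inter> H \<noteq> {})"
proof (cases "I = {}")
  case True
  with p show ?thesis by (intro exI[of _ "{}"]) auto
next
  case False
  define K where "K = card X"
  define m where "m = nat \<lfloor>p * K\<rfloor>"
  have NK: "N \<le> K"
    using False B card_mono[OF X] unfolding K_def by (metis all_not_in_conv)
  have cI: "real (card I) \<ge> 1"
    using False I by (simp add: Suc_leI card_gt_0_iff)
  \<comment> \<open>If \<open>X\<close> were empty, then \<open>N = 0\<close> and
    \<open>less\<close> would bound \<open>card I * exp 1\<close> by 1 although \<open>I\<close> is
    nonempty.\<close>
  have "K > 0"
  proof (rule ccontr)
    assume "\<not> K > 0"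
    with NK have "real (card I) * exp 1 < 1" using less by simp
    moreover have "1 * 1 \<le> real (card I) * exp 1"
      using cI by (intro mult_mono) auto
    ultimately show False by simp
  qed
  have m_le: "real m \<le> p * K" and m_ge: "real m \<ge> p * K - 1"
    proof -
    have "0 \<le> p * K" using p by simp
    then show "real m \<le> p * K" "real m \<ge> p * K - 1"
      unfolding m_def by linarith+
  qed
  have "(1 - N / K) ^ m \<le> exp (- (N / K)) ^ m"
    using exp_ge_add_one_self[of "- (N / K)"] NK \<open>K > 0\<close> by (intro power_mono) auto
  also have "\<dots> = exp (- (N / K * m))"
    by (simp add: exp_of_nat_mult[symmetric] mult.commute)
  \<comment> \<open>Rounding \<open>p * K\<close> down loses less than one draw, hence at most
    \<open>N / K \<le> 1\<close> in the exponent; this is the 1 in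
    \<open>exp (1 - p * N)\<close>.\<close>
  also have "\<dots> \<le> exp (1 - p * N)"
  proof -
    have "N / K * m \<ge> N / K * (p * K - 1)"
      using m_ge by (intro mult_left_mono) auto
    moreover have "N / K * (p * K - 1) = p * N - N / K"
      using \<open>K > 0\<close> by (simp add: field_simps)
    moreover have "N / K \<le> 1" using NK \<open>K > 0\<close> by simp
    ultimately show ?thesis by simp
  qed
  finally have "real (card I) * (1 - N / K) ^ m \<le> real (card I) * exp (1 - p * N)"
    by (intro mult_left_mono) auto
  with less have "real (card I) * (1 - N / K) ^ m < 1" by linarith
  then have "real (card I) * (1 - N / K) ^ m * real K ^ m < real K ^ m"
    using \<open>K > 0\<close> by simp
  moreover have "(1 - N / K) ^ m * real K ^ m = (real (K - N)) ^ m"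
    using \<open>K > 0\<close> NK by (simp flip: power_mult_distrib add: of_nat_diff left_diff_distrib)
  ultimately have "real (card I * (K - N) ^ m) < real (K ^ m)"
    by (simp add: mult.assoc)
  then have "card I * (card X - N) ^ m < card X ^ m"
    unfolding K_def by linarith
  then have "\<exists>H. H \<subseteq> X \<and> card H \<le> m \<and> (\<forall>i\<in>I. B i \<inter> H \<noteq> {})"
    by (intro hitting_set_count[where N = N] X I B)
  with m_le show ?thesis
    unfolding K_def by (meson of_nat_mono order_trans)
qed

section \<open>Matrices of bounded distortion\<close>

text \<open>The entry bound leaves only finitely many matrices after rounding the entries to a grid;
  the lower bound on \<open>T *v v\<close> keeps separated points separated.\<close>

definition distortion :: "nat \<Rightarrow> (real^'n^'n) set" where
  "distortion M = {T. (\<forall>i j. \<bar>T $ i $ j\<bar> \<le> M) \<and> (\<forall>v. norm v \<le> M * norm (T *v v))}"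

text \<open>\<open>M\<close> dominates 1, all entries of \<open>T\<close>, and a bound
  \<open>c\<close> for the left inverse \<open>S\<close>, since
  \<open>norm v = norm (S *v (T *v v)) \<le> c * norm (T *v v)\<close>. Thus the classes with
  \<open>M \<ge> 1\<close> exhaust the invertible matrices.\<close>

lemma invertible_distortion:
  fixes T :: "real^'n^'n"
  assumes "invertible T"
  shows "\<exists>M\<ge>1. T \<in> distortion M"
proof -
  obtain S where S: "S ** T = mat 1"
    using assms unfolding invertible_def by blast
  obtain c where c: "\<And>v. norm (S *v v) \<le> norm v * c"
    using bounded_linear.bounded[OF matrix_vector_mul_bounded_linear[of S]] by blast
  define b where "b = Max ((\<lambda>(i, j). \<bar>T $ i $ j\<bar>) ` UNIV)"
  have b: "\<bar>T $ i $ j\<bar> \<le> b" for i j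
    unfolding b_def by (rule Max_ge) (auto intro: rev_image_eqI[of "(i, j)"])
  define M where "M = nat \<lceil>max 1 (max b c)\<rceil>"
  have M: "real M \<ge> 1" "real M \<ge> b" "real M \<ge> c"
    unfolding M_def by linarith+
  have "norm v \<le> M * norm (T *v v)" for v
  proof -
    have "norm v = norm (S *v (T *v v))"
      by (simp add: matrix_vector_mul_assoc S)
    also have "\<dots> \<le> norm (T *v v) * c" by (rule c)
    also have "\<dots> \<le> norm (T *v v) * M" using M by (intro mult_left_mono) auto
    finally show ?thesis by (simp add: mult.commute)
  qed
  with b M have "T \<in> distortion M"
    unfolding distortion_def by (auto intro: order_trans)
  with M show ?thesis by auto
qed

lemma abs_matrix_vector_le:
  fixes T :: "real^'n^'n" and c :: real
  assumes "\<And>i j. \<bar>T $ i $ j\<bar> \<le> c"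
  shows "\<bar>(T *v v) $ i\<bar> \<le> CARD('n) * c * norm v"
proof -
  have "\<bar>(T *v v) $ i\<bar> \<le> (\<Sum>j\<in>UNIV. \<bar>T $ i $ j * v $ j\<bar>)"
    unfolding matrix_vector_mult_def by simp
  also have "\<dots> \<le> (\<Sum>j\<in>(UNIV :: 'n set). c * norm v)"
    unfolding abs_mult
    by (intro sum_mono mult_mono assms component_le_norm_cart)
       (auto intro: order_trans[OF abs_ge_zero assms])
  finally show ?thesis by simp
qed

section \<open>Counting grid points and measuring unions of boxes\<close>

lemma card_int_funs:
  "card {f :: 'k::finite \<Rightarrow> int. \<forall>i. f i \<in> {- int c..int c}} = (2 * c + 1) ^ CARD('k)"
proof -
  have "{f :: 'k \<Rightarrow> int. \<forall>i. f i \<in> {- int c..int c}} = PiE UNIV (\<lambda>_. {- int c..int c})"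
    by (auto simp: PiE_iff)
  then show ?thesis by (simp add: card_PiE nat_add_distrib nat_mult_distrib)
qed

lemma finite_int_funs: "finite {f :: 'k::finite \<Rightarrow> int. \<forall>i. f i \<in> {- int c..int c}}"
  \<comment> \<open>\<open>card\<close> of an infinite set is 0, so the positive count already gives
    finiteness.\<close>
  by (rule card_ge_0_finite) (simp add: card_int_funs del: atLeastAtMost_iff)

lemma floor_in_int_interval:
  fixes y :: real and c :: nat
  assumes "\<bar>y\<bar> \<le> c"
  shows "\<lfloor>y\<rfloor> \<in> {- int c..int c}"
  using assms by (auto simp: le_floor_iff floor_le_iff abs_le_iff)


lemma emeasure_UN_boxes_le:
  fixes l u :: "'i \<Rightarrow> real^'n" and s :: real
  assumes "finite H" and "\<And>k i. u k $ i = l k $ i + s" and "s \<ge> 0"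
  shows "emeasure lebesgue (\<Union>k\<in>H. box (l k) (u k)) \<le> ennreal (card H * s ^ CARD('n))"
proof -
  have cart: "emeasure lebesgue (box (l k) (u k)) \<le> ennreal (s ^ CARD('n))" for k
  proof -
    have "emeasure lebesgue (box (l k) (u k)) \<le> emeasure lebesgue (cbox (l k) (u k))"
      by (intro emeasure_mono box_subset_cbox) auto
    also have "\<dots> = ennreal (measure lborel (cbox (l k) (u k)))"
      by (simp add: emeasure_eq_ennreal_measure emeasure_lborel_cbox_eq)
    also have "measure lborel (cbox (l k) (u k)) = (\<Prod>i\<in>UNIV. u k $ i - l k $ i)"
      using assms by (intro content_cbox_cart) (auto simp: interval_ne_empty_cart)
    finally show ?thesis using assms by simp
  qed
  have "emeasure lebesgue (\<Union>k\<in>H. box (l k) (u k)) \<le> (\<Sum>k\<in>H. emeasure lebesgue (box (l k) (u k)))"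
    by (intro emeasure_subadditive_finite assms) auto
  also have "\<dots> \<le> (\<Sum>k\<in>H. ennreal (s ^ CARD('n)))"
    by (intro sum_mono cart)
  also have "\<dots> = ennreal (card H * s ^ CARD('n))"
    using assms by (simp add: ennreal_mult ennreal_of_nat_eq_real_of_nat)
  finally show ?thesis .
qed

section \<open>An open hitting set for the copies of a normalised finite set\<close>

text \<open>Two grids are used: space is cut into cells of side \<open>1 / L\<close>, and the
  parameters \<open>(T, x)\<close> are rounded to the finer mesh \<open>1 / L'\<close> with
  \<open>L' = L * (d + 1)\<close>. Pairs with the same code move each point of \<open>F\<close> by
  less than \<open>1 / L\<close> per coordinate, so it suffices to hit one representative per code
  and to enlarge the chosen cells. The power in \<open>less\<close> bounds the number of
  codes.\<close>

lemma grid_hitting_set: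
  fixes F :: "(real^'n) set" and M L :: nat and p \<delta> :: real
  defines "d \<equiv> CARD('n)"
  assumes F: "finite F" "\<And>a. a \<in> F \<Longrightarrow> norm a \<le> 1"
    and sep: "\<And>a b. a \<in> F \<Longrightarrow> b \<in> F \<Longrightarrow> a \<noteq> b \<Longrightarrow> \<delta> \<le> norm (a - b)"
    and M: "M \<ge> 1" and p: "p \<ge> 0" and L: "L \<ge> 1" "d * M \<le> \<delta> * L"
    and less: "real (2 * (L * (d + 1) * M) + 1) ^ (d * d + d) * exp (1 - p * card F) < 1"
  shows "\<exists>G. open G \<and> emeasure lebesgue G \<le> ennreal (p * (9 * (d * M + 1)) ^ d) \<and>
           (\<forall>T\<in>distortion M. \<forall>x\<in>cbox 0 1. (\<lambda>a. T *v a + x) ` F \<inter> G \<noteq> {})"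
proof -
  define W where "W = d * M + 1"
  define L' where "L' = L * (d + 1)"
  \<comment> \<open>For admissible \<open>T\<close>, \<open>x\<close> and \<open>a\<close>, the
    coordinates of \<open>T *v a + x\<close> are at most \<open>d * M + 1 = W\<close> in absolute
    value, so these indices cover all cells that occur.\<close>
  define X where "X = {k :: 'n \<Rightarrow> int. \<forall>i. k i \<in> {- int (L * W)..int (L * W)}}"
  define cell where "cell y = (\<lambda>i. \<lfloor>L * (y $ i)\<rfloor>)" for y :: "real^'n"
  define code where "code = (\<lambda>(T :: real^'n^'n, x :: real^'n).
      (\<lambda>(i, j). \<lfloor>L' * T $ i $ j\<rfloor>, \<lambda>i. \<lfloor>L' * x $ i\<rfloor>))"
  define Q where "Q = (distortion M :: (real^'n^'n) set) \<times> cbox (0 :: real^'n) 1"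
  define I where "I = code ` Q"
  \<comment> \<open>Each occurring code gets one genuine parameter pair from \<open>Q\<close>;
    \<open>B c\<close> is the set of cells met by the copy of \<open>F\<close> for that
    pair.\<close>
  define rep where "rep = inv_into Q code"
  define B where "B c = (case rep c of (T, x) \<Rightarrow> (\<lambda>a. cell (T *v a + x)) ` F)" for c
  \<comment> \<open>The range \<open>L' * M\<close> also serves for the translation part, because
    the coordinates of \<open>x\<close> lie in the unit interval and
    \<open>M \<ge> 1\<close>.\<close>
  define C where "C = {k :: 'n \<times> 'n \<Rightarrow> int. \<forall>i. k i \<in> {- int (L' * M)..int (L' * M)}} \<times>
      {k :: 'n \<Rightarrow> int. \<forall>i. k i \<in> {- int (L' * M)..int (L' * M)}}"
  have "0 < L'" using L by (simp add: L'_def)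
  then have Lpos: "real L > 0" and L'pos: "real L' > 0" using L by simp_all

  have "I \<subseteq> C"
  proof
    fix c assume "c \<in> I"
    then obtain T x where c: "c = code (T, x)" and T: "T \<in> distortion M" and x: "x \<in> cbox 0 1"
      unfolding I_def Q_def by auto
    have "\<bar>L' * T $ i $ j\<bar> \<le> real (L' * M)" for i j
      using T L'pos by (auto simp: distortion_def abs_mult intro!: mult_left_mono)
    moreover have "\<bar>L' * x $ i\<bar> \<le> real (L' * M)" for i
    proof -
      have "\<bar>x $ i\<bar> \<le> real M" using x M by (auto simp: mem_box_cart intro: order_trans[of _ 1])
      then show ?thesis by (auto simp: abs_mult intro!: mult_left_mono)
    qed
    ultimately show "c \<in> C"
      unfolding c code_def C_def
      by (auto simp del: atLeastAtMost_iff of_nat_mult intro!: floor_in_int_interval)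
  qed
  moreover have "finite C" unfolding C_def by (intro finite_cartesian_product finite_int_funs)
  moreover have "card C = (2 * (L' * M) + 1) ^ (d * d + d)"
    unfolding C_def card_cartesian_product card_int_funs by (simp add: d_def power_add)
  ultimately have I: "finite I" and cardI: "card I \<le> (2 * (L' * M) + 1) ^ (d * d + d)"
    by (auto intro: finite_subset) (metis card_mono)
  have "real (card I) * exp (1 - p * card F)
        \<le> real (2 * (L' * M) + 1) ^ (d * d + d) * exp (1 - p * card F)"
    using cardI unfolding of_nat_power[symmetric] by (intro mult_right_mono of_nat_mono) auto
  also have "\<dots> < 1" using less unfolding L'_def .
  finally have I_less: "real (card I) * exp (1 - p * card F) < 1" .

  have rep: "rep c \<in> Q" "code (rep c) = c" if "c \<in> I" for c
    using that unfolding rep_def I_def by (auto intro: inv_into_into f_inv_into_f)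

  have cell_in: "cell (T *v a + x) \<in> X"
    if "T \<in> distortion M" "x \<in> cbox 0 1" "a \<in> F" for T x a
  proof -
    have "\<bar>L * (T *v a + x) $ i\<bar> \<le> real (L * W)" for i
    proof -
      have "\<bar>(T *v a) $ i\<bar> \<le> CARD('n) * real M * norm a"
        using that by (intro abs_matrix_vector_le) (auto simp: distortion_def)
      also have "\<dots> \<le> CARD('n) * real M * 1"
        using F that by (intro mult_left_mono) auto
      finally have "\<bar>(T *v a) $ i\<bar> \<le> d * M" by (simp add: d_def)
      moreover have "\<bar>x $ i\<bar> \<le> 1" using that by (auto simp: mem_box_cart)
      ultimately have "\<bar>(T *v a + x) $ i\<bar> \<le> real W"
        unfolding W_def by simp
      then show ?thesis by (auto simp: abs_mult intro!: mult_left_mono)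
    qed
    then show ?thesis
      unfolding X_def cell_def mem_Collect_eq by (intro allI floor_in_int_interval)
  qed

  \<comment> \<open>Two points of \<open>F\<close> sharing a cell would give
    \<open>norm (T *v (a - b)) < d / L\<close>, hence
    \<open>norm (a - b) < d * M / L \<le> \<delta>\<close>, against the separation. So every copy
    occupies exactly \<open>card F\<close> cells.\<close>
  have cell_inj: "inj_on (\<lambda>a. cell (T *v a + x)) F" if T: "T \<in> distortion M" for T x
  proof (rule inj_onI, rule ccontr)
    fix a b assume ab: "a \<in> F" "b \<in> F" "a \<noteq> b"
      and eq: "cell (T *v a + x) = cell (T *v b + x)"
    have comp: "\<bar>(T *v (a - b)) $ i\<bar> < 1 / L" for i
    proof -
      have "\<lfloor>L * (T *v a + x) $ i\<rfloor> = \<lfloor>L * (T *v b + x) $ i\<rfloor>"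
        using fun_cong[OF eq, of i] by (simp add: cell_def)
      then have "\<bar>L * (T *v a + x) $ i - L * (T *v b + x) $ i\<bar> < 1"
        by linarith
      moreover have "L * (T *v a + x) $ i - L * (T *v b + x) $ i = L * (T *v (a - b)) $ i"
        by (simp add: matrix_vector_mult_diff_distrib right_diff_distrib distrib_left)
      ultimately have "L * \<bar>(T *v (a - b)) $ i\<bar> < 1"
        using Lpos by (simp add: abs_mult)
      then show ?thesis using Lpos by (simp add: field_simps)
    qed
    have "norm (T *v (a - b)) \<le> (\<Sum>i\<in>UNIV. \<bar>(T *v (a - b)) $ i\<bar>)"
      by (rule norm_le_l1_cart)
    also have "\<dots> < (\<Sum>i\<in>(UNIV :: 'n set). 1 / L)"
      by (intro sum_strict_mono comp) auto
    also have "\<dots> = d / L" by (simp add: d_def)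
    finally have "norm (T *v (a - b)) < d / L" .
    have "\<delta> \<le> norm (a - b)" using sep ab by blast
    also have "\<dots> \<le> M * norm (T *v (a - b))"
      using T by (auto simp: distortion_def)
    also have "\<dots> < M * (d / L)"
      using M \<open>norm (T *v (a - b)) < d / L\<close> by (intro mult_strict_left_mono) auto
    finally have "\<delta> * L < d * M" using Lpos by (simp add: field_simps)
    with L show False by simp
  qed

  have B: "B c \<subseteq> X \<and> card (B c) = card F" if "c \<in> I" for c
  proof -
    obtain T x where Tx: "rep c = (T, x)" by force
    with rep[OF that] have "T \<in> distortion M" "x \<in> cbox 0 1" by (auto simp: Q_def)
    then show ?thesis
      unfolding B_def Tx using cell_in card_image[OF cell_inj] by auto
  qed
  have X: "finite X" unfolding X_def by (rule finite_int_funs)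
  have "\<exists>H. H \<subseteq> X \<and> real (card H) \<le> p * card X \<and> (\<forall>c\<in>I. B c \<inter> H \<noteq> {})"
    by (intro hitting_set[where N = "card F"] X I p B I_less)
  then obtain H where H: "H \<subseteq> X" "real (card H) \<le> p * card X" "\<forall>c\<in>I. B c \<inter> H \<noteq> {}"
    by (elim exE conjE)
  \<comment> \<open>The cell of index \<open>k\<close> is extended by a full mesh width on every
    side. The resulting box of side \<open>3 / L\<close> absorbs the error of replacing
    \<open>(T, x)\<close> by its representative.\<close>
  define lo where "lo k = (\<chi> i. (real_of_int (k i) - 1) / real L)" for k :: "'n \<Rightarrow> int"
  define hi where "hi k = (\<chi> i. (real_of_int (k i) + 2) / real L)" for k :: "'n \<Rightarrow> int"
  define G where "G = (\<Union>k\<in>H. box (lo k) (hi k))"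
  have "open G" unfolding G_def by (intro open_UN ballI open_box)
  moreover have "emeasure lebesgue G \<le> ennreal (p * (9 * (d * M + 1)) ^ d)"
  proof -
    have "card H * (3 / L) ^ CARD('n) \<le> p * card X * (3 / L) ^ d"
      using H(2) unfolding d_def by (intro mult_right_mono) auto
    also have "card X = (2 * (L * W) + 1) ^ d"
      unfolding X_def card_int_funs d_def ..
    also have "p * real ((2 * (L * W) + 1) ^ d) * (3 / L) ^ d
        = p * (real (2 * (L * W) + 1) * (3 / L)) ^ d"
      by (simp only: power_mult_distrib of_nat_power mult.assoc)
    \<comment> \<open>The mesh cancels: about \<open>L ^ d\<close> cells against volume
      \<open>(3 / L) ^ d\<close> each. The bound therefore does not depend on \<open>L\<close>,
      however fine the separation forces the grid to be.\<close>
    also have "\<dots> \<le> p * (9 * real W) ^ d"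
    proof -
      have "1 \<le> L * W" using L unfolding W_def by simp
      then have "real (2 * (L * W) + 1) \<le> real (3 * (L * W))"
        unfolding of_nat_le_iff by linarith
      then have "real (2 * (L * W) + 1) * (3 / L) \<le> real (3 * (L * W)) * (3 / L)"
        by (intro mult_right_mono) auto
      also have "\<dots> = 9 * real W" using Lpos by simp
      finally show ?thesis using p by (intro mult_left_mono power_mono) auto
    qed
    also have "\<dots> = p * real ((9 * (d * M + 1)) ^ d)"
      by (simp only: W_def of_nat_power of_nat_mult of_nat_numeral)
    finally have "card H * (3 / L) ^ CARD('n) \<le> p * real ((9 * (d * M + 1)) ^ d)" .
    moreover have "emeasure lebesgue G \<le> ennreal (card H * (3 / L) ^ CARD('n))"
      unfolding G_def using finite_subset[OF H(1) X]
      by (rule emeasure_UN_boxes_le) (simp_all add: lo_def hi_def flip: add_divide_distrib)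
    ultimately show ?thesis by (meson ennreal_leI order_trans)
  qed
  moreover have "(\<lambda>a. T *v a + x) ` F \<inter> G \<noteq> {}"
    if T: "T \<in> distortion M" and x: "x \<in> cbox 0 1" for T x
  proof -
    define c where "c = code (T, x)"
    have "c \<in> I" using T x by (auto simp: c_def I_def Q_def)
    obtain T' x' where Tx': "rep c = (T', x')" by force
    with bspec[OF H(3) \<open>c \<in> I\<close>] obtain a where a: "a \<in> F" "cell (T' *v a + x') \<in> H"
      unfolding B_def by auto
    have "code (T', x') = code (T, x)" using rep[OF \<open>c \<in> I\<close>] Tx' by (simp add: c_def)
    then have T_eq: "\<lfloor>L' * T' $ i $ j\<rfloor> = \<lfloor>L' * T $ i $ j\<rfloor>"
      and x_eq: "\<lfloor>L' * x' $ i\<rfloor> = \<lfloor>L' * x $ i\<rfloor>" for i j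
      unfolding code_def by (auto simp: fun_eq_iff)
    have diff: "\<bar>y - y'\<bar> < 1 / L'" if "\<lfloor>L' * y'\<rfloor> = \<lfloor>L' * y\<rfloor>" for y y' :: real
    proof -
      have "\<bar>L' * y - L' * y'\<bar> < 1" using that by linarith
      moreover have "L' * y - L' * y' = L' * (y - y')" by (simp add: right_diff_distrib)
      ultimately have "L' * \<bar>y - y'\<bar> < 1"
        using L'pos by (simp add: abs_mult)
      then show ?thesis using L'pos by (simp add: field_simps)
    qed
    have T_diff: "\<bar>(T - T') $ i $ j\<bar> < 1 / L'" and x_diff: "\<bar>(x - x') $ i\<bar> < 1 / L'" for i j
      using diff[OF T_eq] diff[OF x_eq] by simp_all
    \<comment> \<open>The matrix error contributes at most \<open>d / L'\<close> and the translation
      error less than \<open>1 / L'\<close>; the choice of \<open>L'\<close> makes the sum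
      \<open>1 / L\<close>.\<close>
    have close: "\<bar>(T *v a + x) $ i - (T' *v a + x') $ i\<bar> < 1 / L" for i
    proof -
      have "\<bar>((T - T') *v a) $ i\<bar> \<le> CARD('n) * (1 / L') * norm a"
        using T_diff by (intro abs_matrix_vector_le) (auto intro: less_imp_le)
      also have "\<dots> \<le> CARD('n) * (1 / L') * 1"
        using F a by (intro mult_left_mono) auto
      finally have "\<bar>((T - T') *v a) $ i\<bar> \<le> d / L'" by (simp add: d_def)
      moreover have "(T *v a + x) $ i - (T' *v a + x') $ i = ((T - T') *v a) $ i + (x - x') $ i"
        by (simp add: matrix_vector_mult_diff_rdistrib)
      moreover have "d / L' + 1 / L' = 1 / L"
      proof -
        have "real L' = L * (1 + real d)" by (simp add: L'_def algebra_simps)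
        moreover have "1 + real d \<noteq> 0" by linarith
        ultimately show ?thesis
          by (simp add: add.commute flip: add_divide_distrib)
      qed
      ultimately show ?thesis using x_diff[of i] by linarith
    qed
    let ?k = "cell (T' *v a + x')"
    have "lo ?k $ i < (T *v a + x) $ i \<and> (T *v a + x) $ i < hi ?k $ i" for i
    proof -
      have "?k i \<le> L * (T' *v a + x') $ i" "L * (T' *v a + x') $ i < ?k i + 1"
        unfolding cell_def by linarith+
      then have "?k i / L \<le> (T' *v a + x') $ i" "(T' *v a + x') $ i < (?k i + 1) / L"
        using Lpos by (simp_all add: field_simps)
      moreover have "lo ?k $ i = ?k i / L - 1 / L" "hi ?k $ i = (?k i + 1) / L + 1 / L"
        by (simp_all add: lo_def hi_def add_divide_distrib diff_divide_distrib)
      ultimately show ?thesis using close[of i] by linarith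
    qed
    then have "T *v a + x \<in> G"
      unfolding G_def using a by (auto simp: mem_box_cart)
    with a show ?thesis by blast
  qed
  ultimately show ?thesis by blast
qed

section \<open>Rescaling and tiling\<close>

text \<open>Writing \<open>x = r * (y + k)\<close> with \<open>k\<close> integral and
  \<open>y\<close> in the unit cube turns \<open>T *v (r *\<^sub>R a) + x\<close> into
  \<open>r * (T *v a + y)\<close> shifted by \<open>r * k\<close>. Hence the translates of the
  scaled \<open>G\<^sub>0\<close> by the lattice of mesh \<open>r\<close> hit every copy.\<close>

lemma tile_hitting_open:
  fixes G\<^sub>0 F :: "(real^'n) set" and B r c :: real
  assumes G\<^sub>0: "open G\<^sub>0" "emeasure lebesgue G\<^sub>0 \<le> ennreal c" and c: "c \<ge> 0"
    and r: "r > 0" and B: "B \<ge> 0"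
    and hit: "\<And>T x. T \<in> D \<Longrightarrow> x \<in> cbox 0 1 \<Longrightarrow> (\<lambda>a. T *v a + x) ` F \<inter> G\<^sub>0 \<noteq> {}"
  shows "\<exists>G. open G \<and> emeasure lebesgue G \<le> ennreal (c * (2 * B + 3 * r) ^ CARD('n)) \<and>
           (\<forall>T\<in>D. \<forall>x. (\<forall>i. \<bar>x $ i\<bar> \<le> B) \<longrightarrow> (\<lambda>a. T *v a + x) ` ((*\<^sub>R) r ` F) \<inter> G \<noteq> {})"
proof -
  define N where "N = nat \<lceil>B / r\<rceil>"
  have "0 \<le> B / r" using r B by simp
  then have N: "B / r \<le> real N" "real N \<le> B / r + 1" unfolding N_def by linarith+
  define K where "K = {k :: 'n \<Rightarrow> int. \<forall>i. k i \<in> {- int N..int N}}"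
  define tile where "tile k = (\<lambda>y. r *\<^sub>R y + r *\<^sub>R (\<chi> i. real_of_int (k i))) ` G\<^sub>0" for k :: "'n \<Rightarrow> int"
  define G where "G = (\<Union>k\<in>K. tile k)"
  have K: "finite K" "card K = (2 * N + 1) ^ CARD('n)"
    unfolding K_def by (rule finite_int_funs, rule card_int_funs)
  have open_tile: "open (tile k)" for k
  proof -
    have "tile k = (+) (r *\<^sub>R (\<chi> i. real_of_int (k i))) ` (*\<^sub>R) r ` G\<^sub>0"
      unfolding tile_def image_image by (simp add: add.commute)
    then show ?thesis using G\<^sub>0 r by (simp add: open_translation open_scaling)
  qed
  have "open G" unfolding G_def using open_tile by auto
  moreover have "emeasure lebesgue G \<le> ennreal (c * (2 * B + 3 * r) ^ CARD('n))"
  proof -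
    have "emeasure lebesgue G \<le> (\<Sum>k\<in>K. emeasure lebesgue (tile k))"
      unfolding G_def using K open_tile by (intro emeasure_subadditive_finite) auto
    also have "\<dots> = (\<Sum>k\<in>K. ennreal (r ^ CARD('n)) * emeasure lebesgue G\<^sub>0)"
      unfolding tile_def emeasure_lebesgue_affine using r by (simp add: ennreal_power)
    also have "\<dots> \<le> (\<Sum>k\<in>K. ennreal (r ^ CARD('n)) * ennreal c)"
      by (intro sum_mono mult_left_mono G\<^sub>0) auto
    also have "\<dots> = ennreal (c * ((2 * N + 1) * r) ^ CARD('n))"
    proof -
      have "(\<Sum>k\<in>K. ennreal (r ^ CARD('n)) * ennreal c) = ennreal (real (card K) * (r ^ CARD('n) * c))"
        using r c by (simp add: ennreal_mult ennreal_of_nat_eq_real_of_nat)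
      then show ?thesis unfolding K by (simp add: power_mult_distrib mult_ac)
    qed
    \<comment> \<open>The number of tiles compensates for their volume, so the total stays bounded
      as \<open>r\<close> tends to 0.\<close>
    also have "\<dots> \<le> ennreal (c * (2 * B + 3 * r) ^ CARD('n))"
    proof -
      have "(2 * N + 1) * r \<le> (2 * (B / r + 1) + 1) * r"
        using N r by (intro mult_right_mono) auto
      also have "\<dots> = 2 * B + 3 * r" using r by (simp add: field_simps)
      finally show ?thesis using c r
        by (intro ennreal_leI mult_left_mono power_mono) auto
    qed
    finally show ?thesis .
  qed
  moreover have "(\<lambda>a. T *v a + x) ` ((*\<^sub>R) r ` F) \<inter> G \<noteq> {}"
    if T: "T \<in> D" and x: "\<forall>i. \<bar>x $ i\<bar> \<le> B" for T x
  proof -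
    \<comment> \<open>Integer and fractional parts of \<open>x / r\<close>, coordinatewise.\<close>
    define k where "k i = \<lfloor>x $ i / r\<rfloor>" for i
    define y where "y = (\<chi> i. x $ i / r - k i)"
    have "\<bar>x $ i / r\<bar> \<le> real N" for i
    proof -
      have "\<bar>x $ i / r\<bar> \<le> B / r" using x r by (simp add: divide_right_mono)
      with N show ?thesis by linarith
    qed
    then have "k \<in> K"
      unfolding K_def k_def by (auto simp del: atLeastAtMost_iff intro!: floor_in_int_interval)
    have "0 \<le> y $ i \<and> y $ i \<le> 1" for i
      unfolding y_def k_def by simp linarith
    then have "y \<in> cbox 0 1" by (simp add: mem_box_cart)
    with hit[OF T] obtain a where a: "a \<in> F" "T *v a + y \<in> G\<^sub>0" by blast
    have "T *v (r *\<^sub>R a) + x = r *\<^sub>R (T *v a + y) + r *\<^sub>R (\<chi> i. real_of_int (k i))"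
      using r by (simp add: vec_eq_iff y_def matrix_vector_mult_scaleR algebra_simps)
    then have "T *v (r *\<^sub>R a) + x \<in> tile k"
      unfolding tile_def using a by blast
    with a \<open>k \<in> K\<close> show ?thesis unfolding G_def by blast
  qed
  ultimately show ?thesis by blast
qed

text \<open>Scaling by \<open>1 / r\<close> reduces to the normalised case, and tiling returns to
  scale \<open>r\<close>. The premise \<open>large\<close> is the logarithm of the counting
  condition there; bounding \<open>r\<close> by \<open>R\<close> makes the measure bound uniform in
  the scale.\<close>

lemma hitting_open:
  fixes F :: "(real^'n) set" and M :: nat and p \<delta> r R B :: real
  defines "d \<equiv> CARD('n)"
  assumes F: "finite F" "\<And>a. a \<in> F \<Longrightarrow> norm a \<le> r"
    and r: "0 < r" "r \<le> R" and B: "B \<ge> 0" and \<delta>: "0 < \<delta>" "\<delta> \<le> 2"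
    and sep: "\<And>a b. a \<in> F \<Longrightarrow> b \<in> F \<Longrightarrow> a \<noteq> b \<Longrightarrow> \<delta> * r \<le> norm (a - b)"
    and M: "M \<ge> 1" and p: "p \<ge> 0"
    and large: "real (d * d + d) * (ln (3 * (d + 1) * M * (d * M + 2)) - ln \<delta>) + 1 < p * card F"
  shows "\<exists>G. open G \<and>
           emeasure lebesgue G \<le> ennreal (p * (9 * (d * M + 1)) ^ d * (2 * B + 3 * R) ^ d) \<and>
           (\<forall>T\<in>distortion M. \<forall>x. (\<forall>i. \<bar>x $ i\<bar> \<le> B) \<longrightarrow> (\<lambda>a. T *v a + x) ` F \<inter> G \<noteq> {})"
proof -
  define F' where "F' = (*\<^sub>R) (1 / r) ` F"
  \<comment> \<open>The coarsest grid that still separates the points of the normalised set.\<close>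
  define L where "L = nat \<lceil>d * M / \<delta>\<rceil>"
  have d: "d \<ge> 1" unfolding d_def by (simp add: Suc_leI)
  have "0 < d * M / \<delta>" using d M \<delta> by simp
  then have L: "L \<ge> 1" "d * M / \<delta> \<le> L" "L \<le> d * M / \<delta> + 1" unfolding L_def by linarith+
  have F_eq: "F = (*\<^sub>R) r ` F'" using r by (simp add: F'_def image_image)
  have card: "card F' = card F"
    unfolding F'_def using r by (intro card_image) (auto simp: inj_on_def)
  \<comment> \<open>The 1 lost by rounding up is at most \<open>2 / \<delta>\<close>, because
    \<open>\<delta> \<le> 2\<close>.\<close>
  have L_le: "real L \<le> (d * M + 2) / \<delta>" using L(3) \<delta> by (simp add: field_simps)
  have less: "real (2 * (L * (d + 1) * M) + 1) ^ (d * d + d) * exp (1 - p * card F') < 1"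
  proof -
    \<comment> \<open>The factor 3 comes from \<open>2 * t + 1 \<le> 3 * t\<close> with
      \<open>t = L * (d + 1) * M\<close>, the rest from the bound on \<open>L\<close>.\<close>
    define C where "C = 3 * (d + 1) * M * (d * M + 2)"
    have "C > 0" using M unfolding C_def by simp
    have "1 \<le> L * (d + 1) * M" using L M by simp
    then have "real (2 * (L * (d + 1) * M) + 1) \<le> real (3 * (L * (d + 1) * M))"
      unfolding of_nat_le_iff by linarith
    also have "\<dots> = 3 * (d + 1) * M * real L" by (simp add: algebra_simps)
    finally have "real (2 * (L * (d + 1) * M) + 1) \<le> 3 * (d + 1) * M * real L" .
    also have "3 * (d + 1) * M * real L \<le> 3 * (d + 1) * M * ((d * M + 2) / \<delta>)"
      using L_le by (intro mult_left_mono) auto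
    also have "\<dots> = C / \<delta>"
      by (simp only: C_def of_nat_mult times_divide_eq_right mult.assoc)
    also have "\<dots> = exp (ln C - ln \<delta>)" using \<open>C > 0\<close> \<delta> by (simp add: exp_diff)
    finally have "real (2 * (L * (d + 1) * M) + 1) ^ (d * d + d) \<le> exp (ln C - ln \<delta>) ^ (d * d + d)"
      by (intro power_mono) auto
    also have "\<dots> = exp (real (d * d + d) * (ln C - ln \<delta>))"
      by (rule exp_of_nat_mult[symmetric])
    finally have "real (2 * (L * (d + 1) * M) + 1) ^ (d * d + d) * exp (1 - p * card F')
        \<le> exp (real (d * d + d) * (ln C - ln \<delta>)) * exp (1 - p * card F')"
      by (intro mult_right_mono) auto
    also have "\<dots> = exp (real (d * d + d) * (ln C - ln \<delta>) + 1 - p * card F)"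
      unfolding card exp_add[symmetric] by (rule arg_cong[of _ _ exp]) linarith
    also have "\<dots> < 1"
      using large unfolding C_def[symmetric] exp_less_one_iff by linarith
    finally show ?thesis .
  qed
  have sep': "\<delta> \<le> norm (a - b)" if "a \<in> F'" "b \<in> F'" "a \<noteq> b" for a b
  proof -
    have "r *\<^sub>R a \<in> F" "r *\<^sub>R b \<in> F" "r *\<^sub>R a \<noteq> r *\<^sub>R b"
      using that r unfolding F_eq by auto
    then have "\<delta> * r \<le> norm (r *\<^sub>R (a - b))" using sep by (simp add: scaleR_diff_right)
    then show ?thesis using r by (simp add: mult.commute)
  qed
  have L_ge: "d * M \<le> \<delta> * L" using L(2) \<delta> by (simp add: field_simps)
  have F': "finite F'" "\<And>a. a \<in> F' \<Longrightarrow> norm a \<le> 1"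
    using F r unfolding F'_def by auto
  have "\<exists>G. open G \<and> emeasure lebesgue G \<le> ennreal (p * (9 * (d * M + 1)) ^ d) \<and>
      (\<forall>T\<in>distortion M. \<forall>x\<in>cbox 0 1. (\<lambda>a. T *v a + x) ` F' \<inter> G \<noteq> {})"
    unfolding d_def
    by (intro grid_hitting_set[where \<delta> = \<delta> and L = L] F' sep' M p L(1)
        L_ge[unfolded d_def] less[unfolded d_def])
  then obtain G\<^sub>0 where G\<^sub>0: "open G\<^sub>0"
      "emeasure lebesgue G\<^sub>0 \<le> ennreal (p * (9 * (d * M + 1)) ^ d)"
      "\<forall>T\<in>distortion M. \<forall>x\<in>cbox 0 1. (\<lambda>a. T *v a + x) ` F' \<inter> G\<^sub>0 \<noteq> {}"
    by (elim exE conjE)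
  have "\<exists>G. open G \<and>
      emeasure lebesgue G \<le> ennreal (p * (9 * (d * M + 1)) ^ d * (2 * B + 3 * r) ^ CARD('n)) \<and>
      (\<forall>T\<in>distortion M. \<forall>x. (\<forall>i. \<bar>x $ i\<bar> \<le> B) \<longrightarrow>
        (\<lambda>a. T *v a + x) ` ((*\<^sub>R) r ` F') \<inter> G \<noteq> {})"
    using p G\<^sub>0(3) by (intro tile_hitting_open[OF G\<^sub>0(1,2) _ r(1) B]) auto
  then obtain G where G: "open G"
      "emeasure lebesgue G \<le> ennreal (p * (9 * (d * M + 1)) ^ d * (2 * B + 3 * r) ^ d)"
      "\<forall>T\<in>distortion M. \<forall>x. (\<forall>i. \<bar>x $ i\<bar> \<le> B) \<longrightarrow> (\<lambda>a. T *v a + x) ` F \<inter> G \<noteq> {}"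
    unfolding F_eq[symmetric] d_def by (elim exE conjE)
  note G(2)
  also have "ennreal (p * (9 * (d * M + 1)) ^ d * (2 * B + 3 * r) ^ d)
      \<le> ennreal (p * (9 * (d * M + 1)) ^ d * (2 * B + 3 * R) ^ d)"
    using p r B by (intro ennreal_leI mult_left_mono power_mono) auto
  finally show ?thesis using G(1,3) by blast
qed

section \<open>The separation ratio and the choice of the finite set\<close>

text \<open>With two distinct points the minimum and maximum are attained. Taking \<open>r\<close>
  to be the maximal norm, \<open>0 < norm (a - b) \<le> 2 * r\<close> gives both
  \<open>r > 0\<close> and the upper bound 2 on the ratio.\<close>

lemma sep_ratio_props:
  fixes F :: "(real^'n) set"
  assumes F: "finite F" "card F \<ge> 2" and R: "\<And>a. a \<in> F \<Longrightarrow> norm a \<le> R"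
  shows "\<exists>r>0. r \<le> R \<and> (\<forall>a\<in>F. norm a \<le> r) \<and>
           (\<forall>a\<in>F. \<forall>b\<in>F. a \<noteq> b \<longrightarrow> sep_ratio F * r \<le> norm (a - b)) \<and>
           0 < sep_ratio F \<and> sep_ratio F \<le> 2"
proof -
  define S where "S = {norm (x - y) | x y. x \<in> F \<and> y \<in> F \<and> x \<noteq> y}"
  define r where "r = Max {norm z | z. z \<in> F}"
  obtain a b where ab: "a \<in> F" "b \<in> F" "a \<noteq> b"
    using F card_le_Suc0_iff_eq[OF F(1)] by auto
  have "S \<subseteq> (\<lambda>(x, y). norm (x - y)) ` (F \<times> F)" unfolding S_def by auto
  then have S: "finite S" using F(1) by (auto intro: finite_subset)
  have "norm (a - b) \<in> S" unfolding S_def using ab by blast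
  then have MinS: "Min S \<in> S" using S by (intro Min_in) auto
  have r_ge: "norm z \<le> r" if "z \<in> F" for z
    unfolding r_def using F(1) that by (intro Max_ge) (auto simp: Setcompr_eq_image)
  have "r \<in> {norm z | z. z \<in> F}"
    unfolding r_def using F(1) ab by (intro Max_in) (auto simp: Setcompr_eq_image)
  then have "r \<le> R" using R by auto
  have "norm (a - b) \<le> norm a + norm b" by (rule norm_triangle_ineq4)
  then have ab_le: "norm (a - b) \<le> 2 * r" using r_ge[OF ab(1)] r_ge[OF ab(2)] by linarith
  have "0 < norm (a - b)" using ab by simp
  with ab_le have "r > 0" by linarith
  have eq: "sep_ratio F = Min S / r"
    unfolding sep_ratio_def S_def r_def ..
  have "Min S > 0" using MinS unfolding S_def by auto
  then have "sep_ratio F > 0" using eq \<open>r > 0\<close> by simp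
  moreover have "Min S \<le> 2 * r" using Min_le[OF S \<open>norm (a - b) \<in> S\<close>] ab_le by linarith
  then have "sep_ratio F \<le> 2" using eq \<open>r > 0\<close> by (simp add: divide_le_eq)
  moreover have "sep_ratio F * r \<le> norm (x - y)" if "x \<in> F" "y \<in> F" "x \<noteq> y" for x y
  proof -
    have "Min S \<le> norm (x - y)" using S that by (intro Min_le) (auto simp: S_def)
    then show ?thesis using eq \<open>r > 0\<close> by simp
  qed
  ultimately show ?thesis using \<open>r > 0\<close> \<open>r \<le> R\<close> r_ge by blast
qed

text \<open>The proportion \<open>p\<close> is fixed first, from \<open>e\<close>, \<open>M\<close>,
  \<open>B\<close> and \<open>R\<close> alone; only then is \<open>n\<close> taken large enough for
  the counting condition. A set hitting all copies of \<open>S n\<close> also hits those of the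
  larger \<open>A\<close>.\<close>

lemma exists_hitting_open:
  fixes A :: "(real^'n) set" and S :: "nat \<Rightarrow> (real^'n) set" and M :: nat and e R B :: real
  assumes R: "\<And>a. a \<in> A \<Longrightarrow> norm a \<le> R"
    and S: "\<And>n. n \<ge> 1 \<Longrightarrow> finite (S n) \<and> S n \<subseteq> A"
    and card_S: "filterlim (\<lambda>n. card (S n)) at_top sequentially"
    and ratio: "(\<lambda>n. - ln (sep_ratio (S n)) / real (card (S n))) \<longlonglongrightarrow> 0"
    and M: "M \<ge> 1" and e: "e > 0" and B: "B \<ge> 0"
  shows "\<exists>G. open G \<and> emeasure lebesgue G \<le> ennreal e \<and>
           (\<forall>T\<in>distortion M. \<forall>x. (\<forall>i. \<bar>x $ i\<bar> \<le> B) \<longrightarrow> (\<lambda>a. T *v a + x) ` A \<inter> G \<noteq> {})"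
proof -
  define d where "d = CARD('n)"
  \<comment> \<open>The maximum with 1 ensures a positive radius, hence
    \<open>P > 0\<close>.\<close>
  define R' where "R' = max 1 R"
  define P where "P = (9 * (real d * M + 1)) ^ d * (2 * B + 3 * R') ^ d"
  define p where "p = e / P"
  define D where "D = real (d * d + d)"
  define C where "C = ln (real (3 * (d + 1) * M * (d * M + 2)))"
  have "d > 0" unfolding d_def by simp
  then have D: "D > 0" unfolding D_def of_nat_0_less_iff by simp
  have "2 * B + 3 * R' > 0" using B unfolding R'_def by linarith
  then have P: "P > 0" unfolding P_def by (simp add: add_nonneg_pos)
  then have p: "p > 0" unfolding p_def using e by simp
  \<comment> \<open>The budget \<open>p * card (S n)\<close> is split in halves: the ratio
    hypothesis keeps \<open>D * (- ln (sep_ratio (S n)))\<close> below one half, and growth of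
    \<open>card (S n)\<close> makes the other at least \<open>D * C + 1\<close>.\<close>
  have ev_ratio: "eventually (\<lambda>n. - ln (sep_ratio (S n)) / real (card (S n)) < p / (2 * D)) sequentially"
    using ratio p D by (intro order_tendstoD(2)) auto
  \<comment> \<open>The lower bound 2 ensures that \<open>sep_ratio (S n)\<close> is a meaningful
    value.\<close>
  have ev_card: "eventually (\<lambda>n. card (S n) \<ge> max 2 (nat \<lceil>2 * (D * C + 1) / p\<rceil>)) sequentially"
    using card_S unfolding filterlim_at_top by blast
  have ev_ge: "eventually (\<lambda>n. n \<ge> (1 :: nat)) sequentially" by (rule eventually_ge_at_top)
  obtain n where n: "n \<ge> 1"
      "- ln (sep_ratio (S n)) / real (card (S n)) < p / (2 * D)"
      "card (S n) \<ge> 2" "card (S n) \<ge> nat \<lceil>2 * (D * C + 1) / p\<rceil>"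
    using eventually_happens[OF eventually_conj[OF ev_ratio eventually_conj[OF ev_card ev_ge]]]
    by auto
  have fin: "finite (S n)" and sub: "S n \<subseteq> A" using S n(1) by auto
  have S_R': "norm a \<le> R'" if "a \<in> S n" for a
    using R[of a] sub that unfolding R'_def by auto
  have "\<exists>r>0. r \<le> R' \<and> (\<forall>a\<in>S n. norm a \<le> r) \<and>
      (\<forall>a\<in>S n. \<forall>b\<in>S n. a \<noteq> b \<longrightarrow> sep_ratio (S n) * r \<le> norm (a - b)) \<and>
      0 < sep_ratio (S n) \<and> sep_ratio (S n) \<le> 2"
    by (intro sep_ratio_props fin n(3) S_R')
  then obtain r where r: "r > 0" "r \<le> R'" "\<forall>a\<in>S n. norm a \<le> r"
      "\<forall>a\<in>S n. \<forall>b\<in>S n. a \<noteq> b \<longrightarrow> sep_ratio (S n) * r \<le> norm (a - b)"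
      "0 < sep_ratio (S n)" "sep_ratio (S n) \<le> 2"
    by (elim exE conjE)
  have "D * (C - ln (sep_ratio (S n))) + 1 < p * card (S n)"
  proof -
    have "real (card (S n)) > 0" using n(3) by simp
    then have "D * (- ln (sep_ratio (S n))) < p * card (S n) / 2"
      using n(2) D by (simp add: field_simps)
    moreover have "2 * (D * C + 1) / p \<le> card (S n)" using n(4) by linarith
    then have "D * C + 1 \<le> p * card (S n) / 2" using p by (simp add: field_simps)
    ultimately show ?thesis by (simp add: algebra_simps)
  qed
  then have large: "real (CARD('n) * CARD('n) + CARD('n)) *
        (ln (real (3 * (CARD('n) + 1) * M * (CARD('n) * M + 2))) - ln (sep_ratio (S n))) + 1
      < p * card (S n)"
    unfolding D_def C_def d_def .
  have "\<exists>G. open G \<and>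
      emeasure lebesgue G \<le> ennreal (p * (9 * (d * M + 1)) ^ d * (2 * B + 3 * R') ^ d) \<and>
      (\<forall>T\<in>distortion M. \<forall>x. (\<forall>i. \<bar>x $ i\<bar> \<le> B) \<longrightarrow> (\<lambda>a. T *v a + x) ` S n \<inter> G \<noteq> {})"
    unfolding d_def
    using r(3,4) by (intro hitting_open[OF fin _ r(1,2) B r(5,6) _ M less_imp_le[OF p] large]) auto
  then obtain G where G: "open G"
      "emeasure lebesgue G \<le> ennreal (p * (9 * (d * M + 1)) ^ d * (2 * B + 3 * R') ^ d)"
      "\<forall>T\<in>distortion M. \<forall>x. (\<forall>i. \<bar>x $ i\<bar> \<le> B) \<longrightarrow> (\<lambda>a. T *v a + x) ` S n \<inter> G \<noteq> {}"
    by (elim exE conjE)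
  have "p * (9 * (d * M + 1)) ^ d * (2 * B + 3 * R') ^ d = p * P"
    unfolding P_def by (simp add: mult.assoc add_ac)
  also have "\<dots> = e" unfolding p_def using P by simp
  finally have "emeasure lebesgue G \<le> ennreal e" using G(2) by simp
  moreover have "(\<lambda>a. T *v a + x) ` A \<inter> G \<noteq> {}"
    if "T \<in> distortion M" "\<forall>i. \<bar>x $ i\<bar> \<le> B" for T x
  proof -
    have "(\<lambda>a. T *v a + x) ` S n \<inter> G \<noteq> {}" using G(3) that by simp
    with sub show ?thesis by auto
  qed
  ultimately show ?thesis using G(1) by auto
qed

section \<open>Removing the hitting sets from the unit cube\<close>

theorem theorem2p1:
  fixes A :: "(real^'n) set"
  assumes "bounded A" and "infinite A"
    and "\<exists>S :: nat \<Rightarrow> (real^'n) set.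
           (\<forall>n\<ge>1. finite (S n) \<and> S n \<subseteq> A) \<and>
           filterlim (\<lambda>n. card (S n)) at_top sequentially \<and>
           (\<lambda>n. - ln (sep_ratio (S n)) / real (card (S n))) \<longlonglongrightarrow> 0"
  shows "\<exists>E :: (real^'n) set.
           closed E \<and> E \<subseteq> cbox 0 1 \<and> emeasure lebesgue E > 0 \<and>
           contains_no_affine_copies E A"
proof -
  obtain S :: "nat \<Rightarrow> (real^'n) set" where S: "\<And>n. n \<ge> 1 \<Longrightarrow> finite (S n) \<and> S n \<subseteq> A"
      "filterlim (\<lambda>n. card (S n)) at_top sequentially"
      "(\<lambda>n. - ln (sep_ratio (S n)) / real (card (S n))) \<longlonglongrightarrow> 0"
    using assms(3) by blast
  obtain R where R: "R > 0" "\<And>a. a \<in> A \<Longrightarrow> norm a \<le> R"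
    using assms(1) unfolding bounded_pos by blast
  \<comment> \<open>A copy inside the unit cube has
    \<open>\<bar>x $ i\<bar> \<le> 1 + \<bar>(T *v a) $ i\<bar>\<close> for \<open>a\<close> in
    \<open>A\<close>, and the last term is at most \<open>CARD('n) * M * R\<close>. Only
    translations in this range need to be hit.\<close>
  define B where "B M = 1 + CARD('n) * real M * R" for M
  have "\<exists>G. open G \<and> emeasure lebesgue G \<le> ennreal ((1 / 2) ^ Suc (Suc m)) \<and>
         (\<forall>T\<in>distortion (Suc m). \<forall>x. (\<forall>i. \<bar>x $ i\<bar> \<le> B (Suc m)) \<longrightarrow> (\<lambda>a. T *v a + x) ` A \<inter> G \<noteq> {})" for m
  proof (intro exists_hitting_open[where S = S and R = R] R(2) S)
    show "0 \<le> B (Suc m)" unfolding B_def using R(1) by simp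
  qed auto
  then have "\<exists>G. \<forall>m. open (G m) \<and> emeasure lebesgue (G m) \<le> ennreal ((1 / 2) ^ Suc (Suc m)) \<and>
      (\<forall>T\<in>distortion (Suc m). \<forall>x. (\<forall>i. \<bar>x $ i\<bar> \<le> B (Suc m)) \<longrightarrow>
        (\<lambda>a. T *v a + x) ` A \<inter> G m \<noteq> {})"
    by (intro choice allI)
  then obtain G where all_G: "\<forall>m. open (G m) \<and>
      emeasure lebesgue (G m) \<le> ennreal ((1 / 2) ^ Suc (Suc m)) \<and>
      (\<forall>T\<in>distortion (Suc m). \<forall>x. (\<forall>i. \<bar>x $ i\<bar> \<le> B (Suc m)) \<longrightarrow>
        (\<lambda>a. T *v a + x) ` A \<inter> G m \<noteq> {})"
    by (elim exE)
  have G: "open (G m)" "emeasure lebesgue (G m) \<le> ennreal ((1 / 2) ^ Suc (Suc m))"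
    "T \<in> distortion (Suc m) \<Longrightarrow> \<forall>i. \<bar>x $ i\<bar> \<le> B (Suc m) \<Longrightarrow>
      (\<lambda>a. T *v a + x) ` A \<inter> G m \<noteq> {}" for m T x
    using all_G by blast+
  define U where "U = (\<Union>m. G m)"
  define E where "E = cbox 0 1 - U"
  have "open U" unfolding U_def using G(1) by auto
  then have "closed E" unfolding E_def by (intro closed_Diff) auto
  moreover have "emeasure lebesgue E > 0"
  proof (rule ccontr)
    assume "\<not> emeasure lebesgue E > 0"
    then have E0: "emeasure lebesgue E = 0" by simp
    \<comment> \<open>The exponent starts at 2, so the removed sets have total measure at most
      \<open>1 / 2\<close>, less than that of the cube.\<close>
    have "(\<lambda>m. (1 / 2) ^ Suc (Suc m)) sums (1 / 2 * 1 :: real)"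
      unfolding power_Suc2[of _ "Suc _"] mult.commute[of _ "1 / 2 :: real"]
      by (intro sums_mult power_half_series)
    then have "(\<Sum>m. ennreal ((1 / 2) ^ Suc (Suc m))) = ennreal (1 / 2)"
      by (intro suminf_ennreal_eq) auto
    moreover have "emeasure lebesgue U \<le> (\<Sum>m. emeasure lebesgue (G m))"
      unfolding U_def using G(1) by (intro emeasure_subadditive_countably) auto
    moreover have "(\<Sum>m. emeasure lebesgue (G m)) \<le> (\<Sum>m. ennreal ((1 / 2) ^ Suc (Suc m)))"
      using G(2) by (intro suminf_le) auto
    ultimately have U_le: "emeasure lebesgue U \<le> ennreal (1 / 2)" by (metis order_trans)
    have "measure lborel (cbox 0 (1 :: real^'n)) = 1"
      by (subst content_cbox_cart) (auto simp: interval_ne_empty_cart)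
    then have "1 = emeasure lebesgue (cbox 0 (1 :: real^'n))"
      by (simp add: emeasure_eq_ennreal_measure emeasure_lborel_cbox_eq)
    also have "\<dots> \<le> emeasure lebesgue (E \<union> U)"
      using \<open>closed E\<close> \<open>open U\<close> by (intro emeasure_mono) (auto simp: E_def)
    also have "\<dots> \<le> emeasure lebesgue E + emeasure lebesgue U"
      using \<open>closed E\<close> \<open>open U\<close> by (intro emeasure_subadditive) auto
    also have "\<dots> \<le> ennreal (1 / 2)" using E0 U_le by simp
    finally show False by (subst (asm) ennreal_1[symmetric], subst (asm) ennreal_le_iff) auto
  qed
  moreover have "contains_no_affine_copies E A"
    unfolding contains_no_affine_copies_def affine_copies_def
  proof safe
    fix T :: "real^'n^'n" and x :: "real^'n"
    assume "invertible T" and sub: "(\<lambda>a. T *v a + x) ` A \<subseteq> E"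
    from invertible_distortion[OF this(1)] obtain m where T: "T \<in> distortion (Suc m)"
      by (auto simp: Suc_le_eq dest!: gr0_implies_Suc)
    \<comment> \<open>One point of the copy lying in the cube confines the translation
      \<open>x\<close> to the range covered by \<open>B (Suc m)\<close>.\<close>
    obtain a where a: "a \<in> A" using assms(2) by fastforce
    have "\<forall>i. \<bar>x $ i\<bar> \<le> B (Suc m)"
    proof
      fix i
      have "\<bar>(T *v a) $ i\<bar> \<le> CARD('n) * real (Suc m) * norm a"
        using T by (intro abs_matrix_vector_le) (auto simp: distortion_def)
      also have "\<dots> \<le> CARD('n) * real (Suc m) * R"
        using R a by (intro mult_left_mono) auto
      finally have "\<bar>(T *v a) $ i\<bar> \<le> CARD('n) * real (Suc m) * R" .
      moreover have "T *v a + x \<in> cbox 0 1" using sub a unfolding E_def by blast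
      then have "0 \<le> (T *v a) $ i + x $ i \<and> (T *v a) $ i + x $ i \<le> 1"
        by (auto simp: mem_box_cart)
      ultimately show "\<bar>x $ i\<bar> \<le> B (Suc m)" unfolding B_def by linarith
    qed
    from G(3)[OF T this] sub show False unfolding E_def U_def by blast
  qed
  ultimately show ?thesis unfolding E_def by blast
qed

end
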